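(* Let $d\ge1$ and $n\ge d+1$. Let $\gamma:[-1,1]\to\mathbb{R}^{d\times n}$ be a (continuous) piecewise linear path such that $\gamma(0)\in\mathcal D$ and $\gamma(t)$ is regular for all $t\ne0$. Suppose also that for every $g\in\mathfrak B_n$ there is at most one $d$-element set $I\subseteq\{1,\dots,n\}$ with $\gamma(0)\in D_{g,I}$. Then the function $t\mapsto|\mathcal M(\gamma(t))|$ is constant for all $t\ne0$ with sufficiently small $|t|$; that is, there is $\delta>0$ such that $|\mathcal M(\gamma(t))|$ takes the same value for all $t$ with $0<|t|<\delta$.
   Context: For $X=(x_1|\dots|x_n)\in\mathbb{R}^{d\times n}$ with columns $x_i\in\mathbb{R}^d$, put $s_k(X)=x_1+\dots+x_k$ for $1\le k\le n$ and $H(X)=\operatorname{Conv}(s_1(X),\dots,s_n(X))$. The group $\mathfrak B_n$ of signed permutations consists of pairs $g=(\sigma,\varepsilon)$, $\sigma$ a permutation of $\{1,\dots,n\}$ and $\varepsilon\in\{\pm1\}^n$, acting by $gX=(\varepsilon_1x_{\sigma(1)}|\dots|\varepsilon_nx_{\sigma(n)})$. Define $\mathcal M(X)=\{g\in\mathfrak B_n:0\notin H(gX)\}$. For $g\in\mathfrak B_n$ and a $d$-element set $I\subseteq\{1,\dots,n\}$, $D_{g,I}$ is the set of $X\in\mathbb{R}^{d\times n}$ such that the vectors $s_i(gX)$, $i\in I$, are linearly dependent; $\mathcal D=\bigcup_{g\in\mathfrak B_n}\bigcup_{|I|=d}D_{g,I}$. $X$ is regular if $X\notin\mathcal D$. 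*)

theory Defs
  imports "HOL-Analysis.Analysis"
begin

text \<open>
  A \<open>d \<times> n\<close> matrix is an element of \<^typ>\<open>real^'n^'d\<close> with \<open>d = CARD('d)\<close> and \<open>n = CARD('n)\<close>.
  The column index type is linearly ordered, and its elements in increasing order play the role
  of \<open>1, \<dots>, n\<close>.
\<close>

definition psum :: "'n \<Rightarrow> real^'n::{finite,linorder}^'d \<Rightarrow> real^'d" where
  "psum k X = (\<Sum>i\<in>{..k}. column i X)"

definition walk_hull :: "real^'n::{finite,linorder}^'d \<Rightarrow> (real^'d) set" where
  "walk_hull X = convex hull (range (\<lambda>k::'n. psum k X))"

type_synonym 'n signed_perm = "('n \<Rightarrow> 'n) \<times> ('n \<Rightarrow> real)"

definition signed_perms :: "'n signed_perm set" where
  "signed_perms = {(\<sigma>, \<epsilon>). \<sigma> permutes UNIV \<and> (\<forall>i. \<epsilon> i \<in> {-1, 1})}"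

definition act :: "'n signed_perm \<Rightarrow> real^'n^'d \<Rightarrow> real^'n^'d" where
  "act g X = (\<chi> r c. snd g c * X $ r $ fst g c)"

definition avoiders :: "real^'n::{finite,linorder}^'d \<Rightarrow> 'n signed_perm set" where
  "avoiders X = {g \<in> signed_perms. 0 \<notin> walk_hull (act g X)}"

text \<open>
  Linear dependence of an indexed family: unlike \<^const>\<open>dependent\<close> of the image \<open>v ` I\<close>, it
  also holds when \<open>v i = v j\<close> for two distinct indices \<open>i, j \<in> I\<close>.
\<close>

definition dependent_family :: "'i set \<Rightarrow> ('i \<Rightarrow> 'a::real_vector) \<Rightarrow> bool" where
  "dependent_family I v \<longleftrightarrow> (\<exists>c. (\<exists>i\<in>I. c i \<noteq> 0) \<and> (\<Sum>i\<in>I. c i *\<^sub>R v i) = 0)"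

definition degenerate_at ::
  "'n signed_perm \<Rightarrow> 'n set \<Rightarrow> (real^'n::{finite,linorder}^'d) set" where
  "degenerate_at g I = {X. dependent_family I (\<lambda>i. psum i (act g X))}"

definition degenerate :: "(real^'n::{finite,linorder}^'d) set" where
  "degenerate = (\<Union>g\<in>signed_perms. \<Union>I\<in>{I. card I = CARD('d)}. degenerate_at g I)"

definition regular :: "real^'n::{finite,linorder}^'d \<Rightarrow> bool" where
  "regular X \<longleftrightarrow> X \<notin> degenerate"

definition piecewise_linear_on :: "real \<Rightarrow> real \<Rightarrow> (real \<Rightarrow> 'a::real_normed_vector) \<Rightarrow> bool" where
  "piecewise_linear_on a b \<gamma> \<longleftrightarrow>
     continuous_on {a..b} \<gamma> \<and>
     (\<exists>(m::nat) (\<tau>::nat \<Rightarrow> real). \<tau> 0 = a \<and> \<tau> m = b \<and> (\<forall>i<m. \<tau> i < \<tau> (Suc i)) \<and>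
        (\<forall>i<m. \<exists>u v. \<forall>t\<in>{\<tau> i..\<tau> (Suc i)}. \<gamma> t = u + t *\<^sub>R v))"

end

theory Submission
  imports Defs
begin

text \<open>
  Let \<open>q\<^sub>j = s\<^sub>j(g X\<^sub>0)\<close> with \<open>X\<^sub>0 = \<gamma>(0)\<close>. Unless the origin lies on the boundary of
  \<open>H(g X\<^sub>0)\<close>, whether \<open>g\<close> belongs to \<open>\<M>(X)\<close> does not change for \<open>X\<close> near \<open>X\<^sub>0\<close>. If it does lie
  there, uniqueness of \<open>I\<close> forces the walk to meet a supporting hyperplane \<open>w\<^sup>\<bottom>\<close> exactly at the times
  in \<open>I\<close>, with the origin in the relative interior of the simplex \<open>q\<^sub>I\<close>. The times in \<open>I\<close> cut the
  walk into blocks; reversing and negating the steps of every block (and keeping those after the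
  last time in \<open>I\<close>) turns \<open>s\<^sub>i\<close> into \<open>-s\<^sub>i\<close> for \<open>i \<in> I\<close> while the other points stay on the positive
  side of \<open>w\<^sup>\<bottom>\<close>. This is an involution \<open>g \<mapsto> g'\<close>, and for regular \<open>X\<close> near \<open>X\<^sub>0\<close> the facets of the two
  hulls lie at opposite nonzero heights, so exactly one of \<open>g, g'\<close> is in \<open>\<M>(X)\<close>. Hence half of
  these \<open>g\<close> contribute, for every regular \<open>X\<close> near \<open>X\<^sub>0\<close>.
\<close>

section \<open>Reflecting the blocks of a walk\<close>

text \<open>Step \<open>i\<close> leads from time \<open>i\<close> to time \<open>Suc i\<close>, and \<open>J\<close> is a set of times. The block of step \<open>k\<close>
  consists of the steps \<open>a, \<dots>, b - 1\<close>, where \<open>a\<close> and \<open>b\<close> are consecutive times in \<open>J \<union> {0}\<close>; the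
  steps after the last time in \<open>J\<close> are in no block.\<close>

definition in_block :: "nat set \<Rightarrow> nat \<Rightarrow> bool" where
  "in_block J k \<longleftrightarrow> (\<exists>b\<in>J. k < b)"

definition block_start :: "nat set \<Rightarrow> nat \<Rightarrow> nat" where
  "block_start J k = Max (insert 0 J \<inter> {..k})"

definition block_end :: "nat set \<Rightarrow> nat \<Rightarrow> nat" where
  "block_end J k = (LEAST b. b \<in> J \<and> k < b)"

text \<open>A block from time a to time b consists of the steps a, ..., b - 1, so its mirror map is
  k -> a + (b - 1) - k.\<close>

definition block_reflect :: "nat set \<Rightarrow> nat \<Rightarrow> nat" where
  "block_reflect J k = (if in_block J k then block_start J k + block_end J k - Suc k else k)"

definition block_sign :: "nat set \<Rightarrow> nat \<Rightarrow> real" where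
  "block_sign J k = (if in_block J k then -1 else 1)"

lemma block_start_eqI:
  assumes "a \<in> insert 0 J" "a \<le> k" "\<And>m. m \<in> J \<Longrightarrow> a < m \<Longrightarrow> k < m"
  shows "block_start J k = a"
  unfolding block_start_def by (rule Max_eqI) (use assms in \<open>auto simp: not_le[symmetric]\<close>)

lemma block_start_props:
  shows "block_start J k \<in> insert 0 J" "block_start J k \<le> k"
    and "m \<in> J \<Longrightarrow> m \<le> k \<Longrightarrow> m \<le> block_start J k"
proof -
  have "block_start J k \<in> insert 0 J \<inter> {..k}"
    unfolding block_start_def by (rule Max_in) auto
  then show "block_start J k \<in> insert 0 J" "block_start J k \<le> k" by auto
  show "m \<in> J \<Longrightarrow> m \<le> k \<Longrightarrow> m \<le> block_start J k"
    unfolding block_start_def by (rule Max_ge) auto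
qed

lemma block_end_eqI:
  assumes "b \<in> J" "k < b" "\<And>m. m \<in> J \<Longrightarrow> k < m \<Longrightarrow> b \<le> m"
  shows "block_end J k = b"
  unfolding block_end_def by (rule Least_equality) (use assms in auto)

lemma block_end_props:
  assumes "in_block J k"
  shows "block_end J k \<in> J" "k < block_end J k"
    and "m \<in> J \<Longrightarrow> k < m \<Longrightarrow> block_end J k \<le> m"
proof -
  obtain b where "b \<in> J \<and> k < b" using assms by (auto simp: in_block_def)
  then have "block_end J k \<in> J \<and> k < block_end J k"
    unfolding block_end_def by (rule LeastI)
  then show "block_end J k \<in> J" "k < block_end J k" by auto
  show "m \<in> J \<Longrightarrow> k < m \<Longrightarrow> block_end J k \<le> m"
    unfolding block_end_def by (rule Least_le) auto
qed

text \<open>No time of \<open>J\<close> lies strictly between the start and the end of a block, so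
  each of its steps sees the same two neighbours in \<open>J\<close> and 0.\<close>

lemma block_same:
  assumes k: "in_block J k" and l: "block_start J k \<le> l" "l < block_end J k"
  shows "in_block J l" "block_start J l = block_start J k" "block_end J l = block_end J k"
proof -
  note e = block_end_props[OF k] and s = block_start_props[where J=J and k=k]
  show "in_block J l" using e(1) l(2) by (auto simp: in_block_def)
  show "block_start J l = block_start J k"
  proof (rule block_start_eqI)
    show "l < m" if "m \<in> J" "block_start J k < m" for m
      using e(3)[OF that(1)] s(3)[OF that(1)] that(2) l(2) by linarith
  qed (use s l in auto)
  show "block_end J l = block_end J k"
  proof (rule block_end_eqI)
    show "block_end J k \<le> m" if "m \<in> J" "l < m" for m
      using e(3)[OF that(1)] s(3)[OF that(1)] that(2) l(1) by linarith
  qed (use e l in auto)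
qed

lemma block_reflect_bounds:
  assumes "in_block J k"
  shows "block_start J k \<le> block_reflect J k" "block_reflect J k < block_end J k"
  using assms block_start_props(2)[of J k] block_end_props(2)[OF assms]
  by (auto simp: block_reflect_def)

lemma in_block_reflect: "in_block J (block_reflect J k) \<longleftrightarrow> in_block J k"
  using block_same(1)[OF _ block_reflect_bounds] by (cases "in_block J k") (auto simp: block_reflect_def)

lemma block_reflect_reflect: "block_reflect J (block_reflect J k) = k"
proof (cases "in_block J k")
  case True
  note b = block_reflect_bounds[OF True] and s = block_same[OF True block_reflect_bounds[OF True]]
  show ?thesis
    using s block_start_props(2)[of J k] block_end_props(2)[OF True] True
    unfolding block_reflect_def[of J "block_reflect J k"]
    by (auto simp: block_reflect_def)
qed (auto simp: block_reflect_def)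

lemma block_reflect_less:
  assumes "J \<subseteq> {..n}" "k < n"
  shows "block_reflect J k < n"
proof (cases "in_block J k")
  case True
  then have "block_end J k \<le> n" using block_end_props(1) assms by blast
  then show ?thesis using block_reflect_bounds[OF True] by simp
qed (use assms in \<open>auto simp: block_reflect_def\<close>)

text \<open>Every completed block contributes the negative of its displacement, so the new walk
  stands at -s_a when a block from a to b begins. Inside it, the negated steps are taken from the
  far end, which adds s_(a+b-k) - s_b. After the last time a of \<open>J\<close> the original steps
  resume from -s_a.\<close>

lemma sum_block_reflect:
  fixes Y :: "nat \<Rightarrow> 'a::real_vector"
  shows "(\<Sum>i<k. block_sign J i *\<^sub>R Y (block_reflect J i)) =
    (if in_block J k
     then (\<Sum>i<block_start J k + block_end J k - k. Y i)
            - (\<Sum>i<block_start J k. Y i) - (\<Sum>i<block_end J k. Y i)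
     else (\<Sum>i<k. Y i) - 2 *\<^sub>R (\<Sum>i<block_start J k. Y i))"
proof (induction k)
  case 0
  have "block_start J 0 = 0" using block_start_props(2)[of J 0] by simp
  then show ?case by simp
next
  case (Suc k)
  define S where "S m = (\<Sum>i<m. Y i)" for m
  define S' where "S' m = (\<Sum>i<m. block_sign J i *\<^sub>R Y (block_reflect J i))" for m
  let ?a = "block_start J k" and ?b = "block_end J k"
  have IH: "S' k = (if in_block J k then S (?a + ?b - k) - S ?a - S ?b else S k - 2 *\<^sub>R S ?a)"
    using Suc.IH unfolding S_def S'_def .
  have step: "S' (Suc k) = S' k + block_sign J k *\<^sub>R Y (block_reflect J k)"
    by (simp add: S'_def)
  have SSuc: "S (Suc m) = S m + Y m" for m by (simp add: S_def)
  have "S' (Suc k) = (if in_block J (Suc k)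
     then S (block_start J (Suc k) + block_end J (Suc k) - Suc k)
          - S (block_start J (Suc k)) - S (block_end J (Suc k))
     else S (Suc k) - 2 *\<^sub>R S (block_start J (Suc k)))"
  proof (cases "in_block J k")
    case True
    note s = block_start_props[where J=J and k=k] and e = block_end_props[OF True]
    have "?a + ?b - k = Suc (?a + ?b - Suc k)" using s e by simp
    then have *: "S' (Suc k) = S (?a + ?b - Suc k) - S ?a - S ?b"
      using True unfolding step IH by (simp add: SSuc block_sign_def block_reflect_def)
    show ?thesis
    proof (cases "Suc k < ?b")
      case True': True
      then show ?thesis using block_same[OF True, of "Suc k"] s(2) * by simp
    next
      case False
      then have b: "?b = Suc k" using e(2) by simp
      have a: "block_start J (Suc k) = Suc k"
        by (rule block_start_eqI) (use b e in auto)
      \<comment> \<open>With \<open>?b = Suc k\<close>, \<open>*\<close> reads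
        \<open>S' (Suc k) = - S (Suc k)\<close>. The right-hand side has this value too, whether a
        new block or the final stretch starts at \<open>Suc k\<close>.\<close>
      show ?thesis using * unfolding a b by (simp add: scaleR_2)
    qed
  next
    case False
    then have F: "\<not> in_block J (Suc k)" by (auto simp: in_block_def)
    have a: "block_start J (Suc k) = ?a"
    proof (rule block_start_eqI)
      show "Suc k < m" if "m \<in> J" "?a < m" for m
        using block_start_props(3)[of m J k] that False by (auto simp: in_block_def not_le[symmetric])
    qed (use block_start_props[where J=J and k=k] in auto)
    show ?thesis
      using False F unfolding step IH a by (simp add: SSuc block_sign_def block_reflect_def)
  qed
  then show ?case unfolding S_def S'_def .
qed

text \<open>A time in \<open>J\<close> is its own block start, and then both cases of the general
  formula collapse to the negative.\<close>

lemma sum_block_reflect_boundary: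
  fixes Y :: "nat \<Rightarrow> 'a::real_vector"
  assumes "k \<in> J"
  shows "(\<Sum>i<k. block_sign J i *\<^sub>R Y (block_reflect J i)) = - (\<Sum>i<k. Y i)"
proof -
  have "block_start J k = k" by (rule block_start_eqI) (use assms in auto)
  then show ?thesis unfolding sum_block_reflect by (simp add: scaleR_2)
qed

text \<open>A reflected block traces its excursion backwards.\<close>

lemma sum_block_reflect_inner_pos:
  fixes Y :: "nat \<Rightarrow> 'a::real_inner"
  assumes J0: "\<And>k. k \<in> J \<Longrightarrow> w \<bullet> (\<Sum>i<k. Y i) = 0" and Jn: "J \<subseteq> {..n}"
    and pos: "\<And>k. 0 < k \<Longrightarrow> k \<le> n \<Longrightarrow> k \<notin> J \<Longrightarrow> 0 < w \<bullet> (\<Sum>i<k. Y i)"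
    and k: "0 < k" "k \<le> n" "k \<notin> J"
  shows "0 < w \<bullet> (\<Sum>i<k. block_sign J i *\<^sub>R Y (block_reflect J i))"
proof -
  let ?a = "block_start J k" and ?b = "block_end J k"
  note s = block_start_props[where J=J and k=k]
  have a0: "w \<bullet> (\<Sum>i<?a. Y i) = 0" using s(1) J0 by auto
  show ?thesis
  proof (cases "in_block J k")
    case True
    note e = block_end_props[OF True]
    \<comment> \<open>The start of the first block may be time 0 without belonging to
      \<open>J\<close>; here \<open>0 < k\<close> enters.\<close>
    have "?a \<noteq> k" using s(1) k by auto
    then have m: "?a < ?a + ?b - k" "?a + ?b - k < ?b" using s e by linarith+
    have "?a + ?b - k \<notin> J"
    proof
      assume "?a + ?b - k \<in> J"
      then show False using s(3)[of "?a + ?b - k"] e(3)[of "?a + ?b - k"] m by linarith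
    qed
    moreover have "?b \<le> n" using e(1) Jn by auto
    ultimately have "0 < w \<bullet> (\<Sum>i<?a + ?b - k. Y i)" using pos m by simp
    then show ?thesis unfolding sum_block_reflect using True a0 J0[OF e(1)]
      by (simp add: inner_diff_right)
  next
    case False
    then show ?thesis unfolding sum_block_reflect using a0 pos[OF k]
      by (simp add: inner_diff_right)
  qed
qed

section \<open>Reversing blocks of a signed permutation\<close>

definition position :: "'n::{finite,linorder} \<Rightarrow> nat" where
  "position k = card {..<k}"

definition at_position :: "nat \<Rightarrow> 'n::{finite,linorder}" where
  "at_position = inv position"

lemma strict_mono_position: "strict_mono (position :: 'n::{finite,linorder} \<Rightarrow> nat)"
  unfolding position_def by (rule strict_monoI, rule psubset_card_mono) auto

lemma inj_position: "inj position"
  using strict_mono_position by (rule strict_mono_imp_inj_on)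

lemma position_le_iff: "position i \<le> position k \<longleftrightarrow> i \<le> k"
  using strict_mono_position by (rule strict_mono_less_eq)

lemma range_position: "range (position :: 'n::{finite,linorder} \<Rightarrow> nat) = {..<CARD('n)}"
proof (rule card_subset_eq)
  show "range (position :: 'n \<Rightarrow> nat) \<subseteq> {..<CARD('n)}"
    unfolding position_def by (auto intro!: psubset_card_mono)
  show "card (range (position :: 'n \<Rightarrow> nat)) = card {..<CARD('n)}"
    by (simp add: card_image[OF inj_position])
qed simp

lemma position_less: "position (k::'n::{finite,linorder}) < CARD('n)"
  using range_position by blast

lemma at_position_position: "at_position (position k) = k"
  unfolding at_position_def by (rule inv_f_f[OF inj_position])

lemma position_at_position: "m < CARD('n) \<Longrightarrow> position (at_position m :: 'n::{finite,linorder}) = m"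
  unfolding at_position_def by (rule f_inv_into_f) (simp add: range_position)

lemma position_image_atMost: "position ` {..k::'n::{finite,linorder}} = {..<Suc (position k)}"
proof -
  have "m \<in> position ` {..k}" if "m \<le> position k" for m
  proof -
    have m: "position (at_position m :: 'n) = m" using that position_less[of k] by (intro position_at_position) simp
    then show ?thesis using that by (intro image_eqI[of _ _ "at_position m"]) (auto simp flip: position_le_iff)
  qed
  then show ?thesis by (auto simp: position_le_iff less_Suc_eq_le)
qed

lemma sum_atMost_position: "(\<Sum>i\<in>{..k}. f i) = (\<Sum>m<Suc (position k). f (at_position m))"
proof -
  have "bij_betw position {..k} {..<Suc (position k)}"
    unfolding bij_betw_def position_image_atMost by (auto intro: inj_on_subset[OF inj_position])
  from sum.reindex_bij_betw[OF this, of "\<lambda>m. f (at_position m)"] show ?thesis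
    by (simp add: at_position_position)
qed

text \<open>\<open>psum i\<close> includes step \<open>position i\<close>, so it is the point of the
  walk at time \<open>Suc (position i)\<close>; time 0 is the origin and corresponds to no
  index.\<close>

definition walk_times :: "'n::{finite,linorder} set \<Rightarrow> nat set" where
  "walk_times I = Suc ` position ` I"

definition reflect_index :: "'n::{finite,linorder} set \<Rightarrow> 'n \<Rightarrow> 'n" where
  "reflect_index I i = at_position (block_reflect (walk_times I) (position i))"

text \<open>The reflection acts on the steps of the walk, that is on the columns of
  \<open>act g X\<close> rather than of \<open>X\<close>; hence both components of \<open>g\<close>
  are precomposed with \<open>reflect_index I\<close>.\<close>

definition reverse_blocks :: "'n::{finite,linorder} set \<Rightarrow> 'n signed_perm \<Rightarrow> 'n signed_perm" where
  "reverse_blocks I g = (\<lambda>i. fst g (reflect_index I i),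
     \<lambda>i. block_sign (walk_times I) (position i) * snd g (reflect_index I i))"

lemma walk_times_subset: "walk_times (I::'n::{finite,linorder} set) \<subseteq> {..CARD('n)}"
  unfolding walk_times_def using position_less by (auto simp: Suc_le_eq)

lemma Suc_position_walk_times: "Suc (position i) \<in> walk_times I \<longleftrightarrow> i \<in> I"
  unfolding walk_times_def using inj_position by (auto dest: injD)

lemma position_reflect_index: "position (reflect_index I i) = block_reflect (walk_times I) (position i)"
  unfolding reflect_index_def
  by (rule position_at_position, rule block_reflect_less[OF walk_times_subset position_less])

lemma reflect_index_reflect_index: "reflect_index I (reflect_index I i) = i"
  unfolding reflect_index_def[of I "reflect_index I i"]
  by (simp add: position_reflect_index block_reflect_reflect at_position_position)

text \<open>The index map is an involution, and a step and its mirror image carry the same block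
  sign, so the two signs multiply to 1.\<close>

lemma reverse_blocks_reverse_blocks: "reverse_blocks I (reverse_blocks I g) = g"
  unfolding reverse_blocks_def
  by (auto simp: reflect_index_reflect_index position_reflect_index block_sign_def in_block_reflect
      prod_eq_iff)

lemma reverse_blocks_signed_perms:
  assumes "g \<in> signed_perms"
  shows "reverse_blocks I g \<in> signed_perms"
proof -
  have "bij (reflect_index I)"
    by (rule involuntory_imp_bij) (rule reflect_index_reflect_index)
  then have "bij (\<lambda>i. fst g (reflect_index I i))"
    using assms bij_comp[of "reflect_index I" "fst g"]
    by (auto simp: signed_perms_def permutes_bij comp_def)
  then show ?thesis using assms
    unfolding signed_perms_def reverse_blocks_def
    by (auto simp: block_sign_def bij_iff permutes_def)
qed

section \<open>Partial sums of the reversed walk\<close>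

lemma column_act: "column i (act g X) = snd g i *\<^sub>R column (fst g i) X"
  by (simp add: column_def act_def vec_eq_iff)

lemma column_act_reverse_blocks:
  "column i (act (reverse_blocks I g) X) =
     block_sign (walk_times I) (position i) *\<^sub>R column (reflect_index I i) (act g X)"
  by (simp add: column_act reverse_blocks_def)

lemma psum_reverse_blocks:
  fixes g :: "'n::{finite,linorder} signed_perm"
  shows "psum k (act (reverse_blocks I g) X) =
    (\<Sum>m<Suc (position k). block_sign (walk_times I) m *\<^sub>R
        column (at_position (block_reflect (walk_times I) m)) (act g X))"
  unfolding psum_def sum_atMost_position
proof (rule sum.cong)
  fix m assume "m \<in> {..<Suc (position k)}"
  then have m: "position (at_position m :: 'n) = m" using position_less[of k] by (intro position_at_position) simp
  show "column (at_position m) (act (reverse_blocks I g) X) = block_sign (walk_times I) m *\<^sub>R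
        column (at_position (block_reflect (walk_times I) m)) (act g X)"
    by (simp add: column_act_reverse_blocks reflect_index_def m)
qed simp

lemma psum_reverse_blocks_boundary:
  assumes "k \<in> I"
  shows "psum k (act (reverse_blocks I g) X) = - psum k (act g X)"
proof -
  have "Suc (position k) \<in> walk_times I" using assms by (simp add: Suc_position_walk_times)
  from sum_block_reflect_boundary[OF this, of "\<lambda>m. column (at_position m) (act g X)"]
  show ?thesis unfolding psum_reverse_blocks unfolding psum_def sum_atMost_position .
qed

lemma psum_reverse_blocks_inner_pos:
  fixes g :: "'n::{finite,linorder} signed_perm" and X :: "real^'n::{finite,linorder}^'d"
  assumes zero: "\<And>i. i \<in> I \<Longrightarrow> w \<bullet> psum i (act g X) = 0"
    and pos: "\<And>i. i \<notin> I \<Longrightarrow> 0 < w \<bullet> psum i (act g X)" and k: "k \<notin> I"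
  shows "0 < w \<bullet> psum k (act (reverse_blocks I g) X)"
  unfolding psum_reverse_blocks
proof (rule sum_block_reflect_inner_pos[of _ _ "\<lambda>m. column (at_position m) (act g X)", OF _ walk_times_subset])
  show "w \<bullet> (\<Sum>m<l. column (at_position m) (act g X)) = 0" if "l \<in> walk_times I" for l
    using that zero unfolding walk_times_def psum_def sum_atMost_position by auto
  show "0 < w \<bullet> (\<Sum>m<l. column (at_position m) (act g X))"
    if l: "0 < l" "l \<le> CARD('n)" "l \<notin> walk_times I" for l
  proof -
    define i :: 'n where "i = at_position (l - 1)"
    have "position i = l - 1" unfolding i_def by (rule position_at_position) (use l in simp)
    then have i: "Suc (position i) = l" using l by simp
    then have "i \<notin> I" using l(3) Suc_position_walk_times by blast
    from pos[OF this] show ?thesis unfolding psum_def sum_atMost_position i .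
  qed
  show "Suc (position k) \<notin> walk_times I" using k by (simp add: Suc_position_walk_times)
  show "Suc (position k) \<le> CARD('n)" using position_less[of k] by simp
qed simp

section \<open>Hulls with the origin on a facet\<close>

lemma dependent_family_mono:
  assumes "dependent_family I v" "I \<subseteq> K" "finite K"
  shows "dependent_family K v"
proof -
  obtain c where c: "\<exists>i\<in>I. c i \<noteq> 0" "(\<Sum>i\<in>I. c i *\<^sub>R v i) = 0"
    using assms(1) by (auto simp: dependent_family_def)
  have "(\<Sum>i\<in>K. (if i \<in> I then c i else 0) *\<^sub>R v i) = (\<Sum>i\<in>I. c i *\<^sub>R v i)"
    using assms by (intro sum.mono_neutral_cong_right) auto
  then show ?thesis unfolding dependent_family_def using c assms(2)
    by (intro exI[of _ "\<lambda>i. if i \<in> I then c i else 0"]) auto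
qed

lemma dependent_family_uminus:
  assumes "\<And>i. i \<in> I \<Longrightarrow> v' i = - v i"
  shows "dependent_family I v' \<longleftrightarrow> dependent_family I v"
proof -
  have "(\<Sum>i\<in>I. c i *\<^sub>R v' i) = - (\<Sum>i\<in>I. c i *\<^sub>R v i)" for c
    using assms by (simp add: sum_negf[symmetric])
  then show ?thesis by (simp add: dependent_family_def)
qed

text \<open>This gives access to the span and dimension theory of sets. A coincidence
  \<open>v i = v j\<close> would be a relation with coefficients 1 and -1.\<close>

lemma not_dependent_family:
  assumes "\<not> dependent_family I v" "finite I"
  shows "inj_on v I" "independent (v ` I)"
proof -
  show inj: "inj_on v I"
  proof (rule inj_onI, rule ccontr)
    fix i j assume ij: "i \<in> I" "j \<in> I" "v i = v j" "i \<noteq> j"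
    let ?c = "\<lambda>k. if k = i then 1 else if k = j then - 1 else (0::real)"
    have "(\<Sum>k\<in>{i, j}. ?c k *\<^sub>R v k) = 0" using ij by simp
    then have "dependent_family {i, j} v" unfolding dependent_family_def
      by (intro exI[of _ ?c]) auto
    then show False using assms ij dependent_family_mono[of "{i, j}" v I] by auto
  qed
  show "independent (v ` I)"
  proof
    assume "dependent (v ` I)"
    then obtain u where "\<exists>x\<in>v ` I. u x \<noteq> 0" "(\<Sum>x\<in>v ` I. u x *\<^sub>R x) = 0"
      using assms(2) by (auto simp: dependent_finite)
    then have "dependent_family I v" unfolding dependent_family_def
      by (intro exI[of _ "\<lambda>i. u (v i)"]) (auto simp: sum.reindex[OF inj])
    then show False using assms(1) by simp
  qed
qed

text \<open>An independent family of this size would span the space, and \<open>w\<close> would be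
  orthogonal to itself.\<close>

lemma dependent_family_if_orthogonal:
  fixes v :: "'i \<Rightarrow> 'a::euclidean_space"
  assumes "w \<noteq> 0" "\<And>i. i \<in> I \<Longrightarrow> w \<bullet> v i = 0" "card I = DIM('a)" "finite I"
  shows "dependent_family I v"
proof (rule ccontr)
  assume nd: "\<not> dependent_family I v"
  note v = not_dependent_family[OF nd assms(4)]
  have "card (v ` I) = DIM('a)" using card_image[OF v(1)] assms(3) by simp
  then have "UNIV \<subseteq> span (v ` I)"
    using v(2) card_ge_dim_independent[of "v ` I" UNIV] by simp
  then have "w \<in> span (v ` I)" by auto
  then have "w \<bullet> w = 0"
    by (rule span_induct) (use assms(2) in \<open>auto simp: subspace_hyperplane\<close>)
  then show False using assms(1) by simp
qed

text \<open>Values on independent vectors can be prescribed; the common value 1 will put a whole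
  facet at one height. The adjoint at 1 is the vector representing the functional.\<close>

lemma exists_functional_one:
  fixes v :: "'i \<Rightarrow> 'a::euclidean_space"
  assumes "\<not> dependent_family I v" "finite I"
  obtains u where "\<And>i. i \<in> I \<Longrightarrow> u \<bullet> v i = 1"
proof -
  obtain f :: "'a \<Rightarrow> real" where f: "linear f" "\<forall>x\<in>v ` I. f x = 1"
    using linear_independent_extend[OF not_dependent_family(2)[OF assms], of "\<lambda>_. 1::real"] by blast
  show thesis
  proof (rule that[of "adjoint f 1"])
    show "adjoint f 1 \<bullet> v i = 1" if "i \<in> I" for i
      using adjoint_works[OF f(1), of "v i" 1] f(2) that by (simp add: inner_commute)
  qed
qed

text \<open>Strict separation of the origin from a compact convex set. The normals are unit vectors
  so that they range over a compact sphere.\<close>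

lemma not_in_hull_iff:
  fixes q :: "'n::finite \<Rightarrow> 'a::euclidean_space"
  shows "0 \<notin> convex hull (range q) \<longleftrightarrow> (\<exists>v. norm v = 1 \<and> (\<forall>j. 0 < v \<bullet> q j))"
proof
  assume "0 \<notin> convex hull (range q)"
  moreover have "closed (convex hull (range q))"
    by (simp add: compact_imp_closed compact_convex_hull finite_imp_compact)
  ultimately obtain a b where a: "a \<noteq> 0" "0 < b" "\<forall>x\<in>convex hull (range q). b < a \<bullet> x"
    using separating_hyperplane_closed_0[OF convex_convex_hull] by blast
  have "0 < a \<bullet> q j" for j
    using a(2,3) hull_inc[of "q j" "range q" convex] by fastforce
  then show "\<exists>v. norm v = 1 \<and> (\<forall>j. 0 < v \<bullet> q j)"
    using a(1) by (intro exI[of _ "sgn a"]) (auto simp: norm_sgn sgn_div_norm)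
next
  assume "\<exists>v. norm v = 1 \<and> (\<forall>j. 0 < v \<bullet> q j)"
  then obtain v where v: "\<And>j. 0 < v \<bullet> q j" by blast
  have "convex hull (range q) \<subseteq> {x. 0 < v \<bullet> x}"
    using v by (intro hull_minimal) (auto simp: convex_halfspace_gt)
  then show "0 \<notin> convex hull (range q)" by auto
qed

lemma in_convex_hull_rangeE:
  fixes q :: "'n::finite \<Rightarrow> 'a::real_vector"
  assumes "x \<in> convex hull (range q)"
  obtains c where "\<And>j. 0 \<le> c j" "sum c UNIV = 1" "(\<Sum>j\<in>UNIV. c j *\<^sub>R q j) = x"
proof -
  obtain u where u: "\<forall>x\<in>range q. 0 \<le> u x" "sum u (range q) = 1" "(\<Sum>x\<in>range q. u x *\<^sub>R x) = x"
    using assms by (auto simp: convex_hull_finite)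
  define s where "s = inv q"
  have inj: "inj_on s (range q)" and qs: "\<And>y. y \<in> range q \<Longrightarrow> q (s y) = y"
    unfolding s_def by (auto intro: inj_on_inv_into f_inv_into_f)
  \<comment> \<open>\<open>q\<close> need not be injective: each point of the range gives its
    coefficient to one chosen preimage, and all other indices get 0.\<close>
  define c where "c j = (if j \<in> s ` range q then u (q j) else 0)" for j
  show thesis
  proof (rule that[of c])
    show "0 \<le> c j" for j using u(1) by (auto simp: c_def)
    have "sum c UNIV = (\<Sum>j\<in>s ` range q. u (q j))"
      unfolding c_def by (rule sum.mono_neutral_cong_right) auto
    also have "\<dots> = sum u (range q)"
      unfolding sum.reindex[OF inj] by (rule sum.cong) (auto simp: qs)
    finally show "sum c UNIV = 1" using u(2) by simp
    have "(\<Sum>j\<in>UNIV. c j *\<^sub>R q j) = (\<Sum>j\<in>s ` range q. u (q j) *\<^sub>R q j)"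
      unfolding c_def by (rule sum.mono_neutral_cong_right) auto
    also have "\<dots> = (\<Sum>x\<in>range q. u x *\<^sub>R x)"
      unfolding sum.reindex[OF inj] by (rule sum.cong) (auto simp: qs)
    finally show "(\<Sum>j\<in>UNIV. c j *\<^sub>R q j) = x" using u(3) by simp
  qed
qed

text \<open>The vectors \<open>q\<^sub>i\<close>, \<open>i \<in> I\<close>, span the facet with inner unit normal \<open>w\<close>, and \<open>l\<close> are positive weights
  placing the origin in its relative interior.\<close>

definition facet_at_origin ::
  "'n set \<Rightarrow> 'a::real_inner \<Rightarrow> ('n \<Rightarrow> real) \<Rightarrow> ('n \<Rightarrow> 'a) \<Rightarrow> bool" where
  "facet_at_origin I w l q \<longleftrightarrow>
     norm w = 1 \<and> I \<noteq> {} \<and> I \<noteq> UNIV \<and>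
     (\<forall>i\<in>I. w \<bullet> q i = 0) \<and> (\<forall>j. j \<notin> I \<longrightarrow> 0 < w \<bullet> q j) \<and>
     (\<forall>i\<in>I. 0 < l i) \<and> (\<Sum>i\<in>I. l i *\<^sub>R q i) = 0 \<and>
     (\<forall>v. (\<forall>i\<in>I. v \<bullet> q i = 0) \<longrightarrow> (\<exists>c. v = c *\<^sub>R w))"

lemma facet_at_originD:
  assumes "facet_at_origin I w l q"
  shows "norm w = 1" "I \<noteq> {}" "I \<noteq> UNIV" "i \<in> I \<Longrightarrow> w \<bullet> q i = 0" "j \<notin> I \<Longrightarrow> 0 < w \<bullet> q j"
    "i \<in> I \<Longrightarrow> 0 < l i" "(\<Sum>i\<in>I. l i *\<^sub>R q i) = 0"
    "(\<And>i. i \<in> I \<Longrightarrow> v \<bullet> q i = 0) \<Longrightarrow> \<exists>c. v = c *\<^sub>R w"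
  using assms unfolding facet_at_origin_def by simp_all

text \<open>All \<open>d\<close>-subsets of the zero set of the supporting functional, and all \<open>d\<close>-sets containing the
  support of the convex combination, are dependent; by uniqueness both sets are the facet.\<close>

lemma facet_at_origin_exists:
  fixes q :: "'n::finite \<Rightarrow> 'a::euclidean_space"
  assumes n: "DIM('a) < CARD('n)"
    and uniq: "\<exists>\<^sub>\<le>\<^sub>1 I. card I = DIM('a) \<and> dependent_family I q"
    and w: "norm w = 1" "\<And>j. 0 \<le> w \<bullet> q j"
    and hull: "0 \<in> convex hull (range q)"
  obtains I l where "card I = DIM('a)" "dependent_family I q" "facet_at_origin I w l q"
proof -
  have uq: "A = B" if "card A = DIM('a)" "dependent_family A q" "card B = DIM('a)" "dependent_family B q"
    for A B using uniq that unfolding Uniq_def by blast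
  have w0: "w \<noteq> 0" using w by auto
  obtain c where c: "\<And>j. 0 \<le> c j" "sum c UNIV = 1" "(\<Sum>j\<in>UNIV. c j *\<^sub>R q j) = 0"
    using in_convex_hull_rangeE[OF hull] by metis
  define I where "I = {j. c j \<noteq> 0}"
  define Z where "Z = {j. w \<bullet> q j = 0}"
  have sumI: "(\<Sum>i\<in>I. c i *\<^sub>R q i) = 0"
    using c(3) by (subst sum.mono_neutral_left[of UNIV I]) (auto simp: I_def)
  have "I \<noteq> {}"
  proof
    assume "I = {}"
    then have "sum c UNIV = 0" by (auto simp: I_def)
    then show False using c(2) by simp
  qed
  then have depI: "dependent_family I q"
    unfolding dependent_family_def using sumI by (auto simp: I_def)
  have "(\<Sum>j\<in>UNIV. c j * (w \<bullet> q j)) = w \<bullet> (\<Sum>j\<in>UNIV. c j *\<^sub>R q j)"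
    by (simp add: inner_sum_right)
  then have "\<forall>j. c j * (w \<bullet> q j) = 0"
    using c(1,3) w(2) by (simp add: sum_nonneg_eq_0_iff)
  then have IZ: "I \<subseteq> Z" by (auto simp: I_def Z_def)
  have depZ: "dependent_family A q" if "A \<subseteq> Z" "card A = DIM('a)" for A
    using w0 that by (intro dependent_family_if_orthogonal[of w]) (auto simp: Z_def)
  have depsup: "dependent_family A q" if "I \<subseteq> A" for A
    using dependent_family_mono[OF depI that] by simp
  have "\<not> card I < DIM('a)"
  proof
    assume less: "card I < DIM('a)"
    obtain A where A: "I \<subseteq> A" "card A = DIM('a)"
      using exists_subset_between[of I "DIM('a)" UNIV] less n by auto
    have "A \<noteq> I" using A(2) less by auto
    then obtain i where i: "i \<in> A" "i \<notin> I" using A(1) by blast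
    \<comment> \<open>Trading the spare element \<open>i\<close> of \<open>A\<close> for
      \<open>j\<close> keeps \<open>I\<close> inside and the size unchanged, which yields a second
      dependent set and contradicts uniqueness.\<close>
    obtain j where j: "j \<notin> A" using A(2) n by (metis UNIV_eq_I less_irrefl)
    have "card (insert j (A - {i})) = DIM('a)" using A i j card_Suc_Diff1[of A i] by simp
    moreover have "I \<subseteq> insert j (A - {i})" using A i by auto
    ultimately have "insert j (A - {i}) = A" using uq A depsup by blast
    then show False using j by blast
  qed
  then obtain A where A: "A \<subseteq> I" "card A = DIM('a)"
    by (meson not_less obtain_subset_with_card_n)
  have AZ: "A = Z"
  proof (rule ccontr)
    assume "A \<noteq> Z"
    \<comment> \<open>The same exchange now takes place inside \<open>Z\<close>, where orthogonality
      to \<open>w\<close> makes every set of this size dependent.\<close>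
    then obtain j where j: "j \<in> Z" "j \<notin> A" using A IZ by blast
    obtain i where i: "i \<in> A" using A(2) DIM_positive[where 'a='a] by fastforce
    have "card (insert j (A - {i})) = DIM('a)" using A i j card_Suc_Diff1[of A i] by simp
    moreover have "insert j (A - {i}) \<subseteq> Z" "A \<subseteq> Z" using A IZ j by auto
    ultimately have "insert j (A - {i}) = A" using uq A depZ by blast
    then show False using j by blast
  qed
  then have cardI: "card I = DIM('a)" and ZI: "Z = I" using A IZ by auto
  obtain j where j: "j \<notin> I" using cardI n by (metis UNIV_eq_I less_irrefl)
  have wpos: "0 < w \<bullet> q k" if "k \<notin> I" for k
    using that w(2)[of k] unfolding ZI[symmetric] Z_def by simp
  have w0I: "w \<bullet> q k = 0" if "k \<in> I" for k
    using that unfolding ZI[symmetric] Z_def by simp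
  have span: "\<exists>a. v = a *\<^sub>R w" if v: "\<And>i. i \<in> I \<Longrightarrow> v \<bullet> q i = 0" for v
  proof -
    obtain i where i: "i \<in> I" using \<open>I \<noteq> {}\<close> by blast
    \<comment> \<open>This \<open>a\<close> makes \<open>v - a *\<^sub>R w\<close> orthogonal to
      \<open>q j\<close>. Replacing one facet index by \<open>j\<close> gives, by uniqueness, an
      independent family of full size, and only 0 is orthogonal to it.\<close>
    define a where "a = (v \<bullet> q j) / (w \<bullet> q j)"
    have "card (insert j (I - {i})) = DIM('a)" using cardI i j card_Suc_Diff1[of I i] by simp
    moreover have "insert j (I - {i}) \<noteq> I" using j by blast
    ultimately have nd: "\<not> dependent_family (insert j (I - {i})) q"
      using uq cardI depI by blast
    have orth: "(v - a *\<^sub>R w) \<bullet> q k = 0" if "k \<in> insert j (I - {i})" for k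
      using that v w0I wpos[OF j] by (auto simp: inner_diff_left a_def)
    have "v - a *\<^sub>R w = 0"
    proof (rule ccontr)
      assume "v - a *\<^sub>R w \<noteq> 0"
      from dependent_family_if_orthogonal[OF this orth \<open>card (insert j (I - {i})) = DIM('a)\<close> finite]
      show False using nd by simp
    qed
    then have "v = a *\<^sub>R w" by simp
    then show ?thesis ..
  qed
  have "facet_at_origin I w c q"
    unfolding facet_at_origin_def
  proof (intro conjI allI impI ballI)
    show "0 < c i" if "i \<in> I" for i using that c(1)[of i] unfolding I_def by simp
    show "\<exists>a. v = a *\<^sub>R w" if "\<forall>i\<in>I. v \<bullet> q i = 0" for v using that by (intro span) blast
    show "I \<noteq> UNIV" using j by blast
  qed (use w(1) \<open>I \<noteq> {}\<close> w0I wpos sumI in simp_all)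
  then show thesis using that cardI depI by blast
qed

section \<open>Stability near a degenerate configuration\<close>

text \<open>By the tube lemma one neighbourhood of \<open>x0\<close> serves all \<open>v\<close> in
  \<open>K\<close> at once. With the unit sphere as \<open>K\<close>, this turns statements about
  directions at \<open>x0\<close> into uniform ones nearby.\<close>

lemma eventually_compact_avoids_closed:
  fixes C :: "('x::topological_space \<times> 'v::topological_space) set"
  assumes "compact K" "closed C" "\<And>v. v \<in> K \<Longrightarrow> (x0, v) \<notin> C"
  shows "\<forall>\<^sub>F x in nhds x0. \<forall>v\<in>K. (x, v) \<notin> C"
proof -
  have C: "open (- C)" "{x0} \<times> K \<subseteq> - C" using assms by auto
  obtain U where U: "x0 \<in> U" "open U" "U \<times> K \<subseteq> - C"
    using Elementary_Topology.tube_lemma[OF assms(1) C] by blast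
  then have "\<forall>x\<in>U. \<forall>v\<in>K. (x, v) \<notin> C" by blast
  then show ?thesis unfolding eventually_nhds using U(1,2) by blast
qed

section \<open>Perturbation when the origin is off the boundary of the hull\<close>

context
  fixes r :: "'n::finite \<Rightarrow> 'x::topological_space \<Rightarrow> 'a::euclidean_space" and x0 :: 'x
  assumes cont: "\<And>j. continuous_on UNIV (r j)"
begin

lemma continuous_snd_inner: "continuous_on UNIV (\<lambda>p. snd p \<bullet> r j (fst p))"
  by (intro continuous_intros continuous_on_compose2[OF cont]) auto

lemma eventually_origin_avoided:
  assumes "norm v = 1" "\<And>j. 0 < v \<bullet> r j x0"
  shows "\<forall>\<^sub>F x in nhds x0. 0 \<notin> convex hull (range (\<lambda>j. r j x))"
proof -
  have "\<forall>\<^sub>F x in nhds x0. 0 < v \<bullet> r j x" for j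
  proof -
    have "open {x. 0 < v \<bullet> r j x}"
      by (intro open_Collect_less continuous_intros cont)
    then show ?thesis using assms(2) unfolding eventually_nhds by blast
  qed
  then have "\<forall>\<^sub>F x in nhds x0. \<forall>j. 0 < v \<bullet> r j x" by (simp add: eventually_all_finite)
  then show ?thesis by eventually_elim (use assms(1) in \<open>auto simp: not_in_hull_iff\<close>)
qed

text \<open>Weak separation is a closed condition on the point and the direction. It fails for all
  unit directions at \<open>x0\<close>, hence by compactness for all of them nearby.\<close>

lemma eventually_origin_in_hull:
  assumes "\<And>v. norm v = 1 \<Longrightarrow> \<exists>j. v \<bullet> r j x0 < 0"
  shows "\<forall>\<^sub>F x in nhds x0. 0 \<in> convex hull (range (\<lambda>j. r j x))"
proof -
  have "\<forall>\<^sub>F x in nhds x0. \<forall>v\<in>sphere 0 1. (x, v) \<notin> {p. \<forall>j. 0 \<le> snd p \<bullet> r j (fst p)}"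
  proof (rule eventually_compact_avoids_closed)
    show "closed {p. \<forall>j. 0 \<le> snd p \<bullet> r j (fst p)}"
      by (intro closed_Collect_all closed_Collect_le continuous_snd_inner continuous_on_const)
    show "(x0, v) \<notin> {p. \<forall>j. 0 \<le> snd p \<bullet> r j (fst p)}" if v: "v \<in> sphere 0 1" for v
    proof -
      obtain j where "v \<bullet> r j x0 < 0" using assms v by auto
      then have "\<not> 0 \<le> v \<bullet> r j x0" by simp
      then show ?thesis by auto
    qed
  qed simp
  then show ?thesis
  proof eventually_elim
    case (elim x)
    show ?case
    proof (rule ccontr)
      assume "0 \<notin> convex hull (range (\<lambda>j. r j x))"
      then obtain v where "norm v = 1" "\<And>j. 0 < v \<bullet> r j x" by (auto simp: not_in_hull_iff)
      then show False using bspec[OF elim, of v] by (simp add: less_imp_le)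
    qed
  qed
qed

section \<open>Perturbation when the origin is on a facet\<close>

context
  fixes I w l
  assumes facet: "facet_at_origin I w l (\<lambda>j. r j x0)"
begin

text \<open>The values of \<open>v\<close> on the facet are nonnegative and their sum with the
  positive weights \<open>l\<close> is 0, so all of them vanish.\<close>

lemma facet_orthogonal:
  assumes "\<And>i. i \<in> I \<Longrightarrow> 0 \<le> v \<bullet> r i x0"
  obtains c where "v = c *\<^sub>R w"
proof -
  have "(\<Sum>i\<in>I. l i * (v \<bullet> r i x0)) = v \<bullet> (\<Sum>i\<in>I. l i *\<^sub>R r i x0)"
    by (simp add: inner_sum_right)
  also have "\<dots> = 0" by (simp add: facet_at_originD(7)[OF facet])
  finally have "(\<Sum>i\<in>I. l i * (v \<bullet> r i x0)) = 0" .
  moreover have "0 \<le> l i * (v \<bullet> r i x0)" if "i \<in> I" for i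
    using assms[OF that] facet_at_originD(6)[OF facet that] by simp
  ultimately have "l i * (v \<bullet> r i x0) = 0" if "i \<in> I" for i
    using that by (subst (asm) sum_nonneg_eq_0_iff) auto
  then have "v \<bullet> r i x0 = 0" if "i \<in> I" for i
    using facet_at_originD(6)[OF facet that] that by fastforce
  then show thesis using facet_at_originD(8)[OF facet] that by blast
qed

text \<open>At \<open>x0\<close> the only weakly separating unit vector is \<open>w\<close> itself,
  so a separator with \<open>v \<bullet> w \<le> 0\<close> is excluded there and, by compactness,
  nearby.\<close>

lemma eventually_separator_near_normal:
  "\<forall>\<^sub>F x in nhds x0. \<forall>v\<in>sphere 0 1. (\<forall>j. 0 \<le> v \<bullet> r j x) \<longrightarrow> 0 < v \<bullet> w"
proof -
  have "\<forall>\<^sub>F x in nhds x0. \<forall>v\<in>sphere 0 1.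
      (x, v) \<notin> {p. (\<forall>j. 0 \<le> snd p \<bullet> r j (fst p)) \<and> snd p \<bullet> w \<le> 0}"
  proof (rule eventually_compact_avoids_closed)
    show "closed {p. (\<forall>j. 0 \<le> snd p \<bullet> r j (fst p)) \<and> snd p \<bullet> w \<le> 0}"
      by (intro closed_Collect_conj closed_Collect_all closed_Collect_le continuous_snd_inner
          continuous_intros)
    fix v assume v: "v \<in> sphere (0::'a) 1"
    show "(x0, v) \<notin> {p. (\<forall>j. 0 \<le> snd p \<bullet> r j (fst p)) \<and> snd p \<bullet> w \<le> 0}"
    proof
      assume "(x0, v) \<in> {p. (\<forall>j. 0 \<le> snd p \<bullet> r j (fst p)) \<and> snd p \<bullet> w \<le> 0}"
      then have a: "\<And>j. 0 \<le> v \<bullet> r j x0" "v \<bullet> w \<le> 0" by auto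
      obtain c where c: "v = c *\<^sub>R w" using facet_orthogonal a(1) by blast
      obtain j where "j \<notin> I" using facet_at_originD(3)[OF facet] by blast
      then have j: "0 < w \<bullet> r j x0" by (rule facet_at_originD(5)[OF facet])
      have "w \<bullet> w = 1" by (simp add: dot_square_norm facet_at_originD(1)[OF facet])
      then have "c \<le> 0" using a(2) c by simp
      moreover have "0 \<le> c" using a(1)[of j] c j by (simp add: zero_le_mult_iff)
      ultimately show False using v c by auto
    qed
  qed simp
  then show ?thesis
  proof eventually_elim
    case (elim x)
    show ?case
    proof (intro ballI impI, rule ccontr)
      fix v assume "v \<in> sphere 0 1" "\<forall>j. 0 \<le> v \<bullet> r j x" "\<not> 0 < v \<bullet> w"
      then show False using bspec[OF elim, of v] by simp
    qed
  qed
qed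

text \<open>At \<open>x0\<close> a functional that is nonpositive on the facet is a multiple of
  \<open>w\<close>; if it is also orthogonal to \<open>w\<close>, it is 0 and not on the
  sphere.\<close>

lemma eventually_no_tangent_separator:
  "\<forall>\<^sub>F x in nhds x0. \<forall>f. f \<bullet> w = 0 \<longrightarrow> (\<exists>i\<in>I. 0 \<le> f \<bullet> r i x)"
proof -
  have "\<forall>\<^sub>F x in nhds x0. \<forall>f\<in>sphere 0 1.
      (x, f) \<notin> {p. snd p \<bullet> w = 0 \<and> (\<forall>i. i \<in> I \<longrightarrow> snd p \<bullet> r i (fst p) \<le> 0)}"
  proof (rule eventually_compact_avoids_closed)
    show "closed {p. snd p \<bullet> w = 0 \<and> (\<forall>i. i \<in> I \<longrightarrow> snd p \<bullet> r i (fst p) \<le> 0)}"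
      by (intro closed_Collect_conj closed_Collect_all closed_Collect_imp closed_Collect_le
          closed_Collect_eq continuous_snd_inner continuous_intros open_Collect_const)
    fix f assume f: "f \<in> sphere (0::'a) 1"
    show "(x0, f) \<notin> {p. snd p \<bullet> w = 0 \<and> (\<forall>i. i \<in> I \<longrightarrow> snd p \<bullet> r i (fst p) \<le> 0)}"
    proof
      assume "(x0, f) \<in> {p. snd p \<bullet> w = 0 \<and> (\<forall>i. i \<in> I \<longrightarrow> snd p \<bullet> r i (fst p) \<le> 0)}"
      then have a: "f \<bullet> w = 0" "\<And>i. i \<in> I \<Longrightarrow> 0 \<le> (- f) \<bullet> r i x0" by auto
      obtain c where c: "- f = c *\<^sub>R w" using facet_orthogonal a(2) by blast
      have "(- f) \<bullet> (- f) = (c *\<^sub>R w) \<bullet> (- f)" using c by (rule arg_cong)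
      then have "f \<bullet> f = 0" using a(1) by (simp add: inner_commute)
      then show False using f by auto
    qed
  qed simp_all
  then show ?thesis
  proof eventually_elim
    case (elim x)
    show ?case
    proof (intro allI impI, rule ccontr)
      fix f assume f: "f \<bullet> w = 0" "\<not> (\<exists>i\<in>I. 0 \<le> f \<bullet> r i x)"
      have "f \<noteq> 0" using f(2) facet_at_originD(2)[OF facet] by auto
      \<comment> \<open>The conditions on \<open>f\<close> are homogeneous, so normalising reduces
        them to the sphere.\<close>
      then have "sgn f \<in> sphere 0 1" by (simp add: norm_sgn)
      moreover have "sgn f \<bullet> w = 0" "\<forall>i\<in>I. sgn f \<bullet> r i x \<le> 0"
        using f by (auto simp: sgn_div_norm not_le divide_simps mult_le_0_iff less_imp_le)
      ultimately show False using elim by auto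
    qed
  qed
qed

text \<open>At \<open>x0\<close> a common height of the facet must be 0, because the weights
  \<open>l\<close> average the facet to the origin. Then \<open>u\<close> is a positive multiple of
  \<open>w\<close>, which is positive off the facet. Nearby, \<open>u\<close> is a normal of the
  perturbed facet.\<close>

lemma eventually_equal_heights_imp_pos:
  "\<forall>\<^sub>F x in nhds x0. \<forall>u\<in>sphere 0 1.
     0 \<le> u \<bullet> w \<and> (\<forall>i\<in>I. \<forall>k\<in>I. u \<bullet> r i x = u \<bullet> r k x) \<longrightarrow> (\<forall>j. j \<notin> I \<longrightarrow> 0 < u \<bullet> r j x)"
proof -
  let ?C = "\<lambda>j. {p. 0 \<le> snd p \<bullet> w \<and> snd p \<bullet> r j (fst p) \<le> 0 \<and>
      (\<forall>i k. i \<in> I \<longrightarrow> k \<in> I \<longrightarrow> snd p \<bullet> r i (fst p) = snd p \<bullet> r k (fst p))}"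
  have "\<forall>\<^sub>F x in nhds x0. \<forall>u\<in>sphere 0 1. (x, u) \<notin> ?C j" if j: "j \<notin> I" for j
  proof (rule eventually_compact_avoids_closed)
    show "closed (?C j)"
      by (intro closed_Collect_conj closed_Collect_all closed_Collect_imp closed_Collect_le
          closed_Collect_eq continuous_snd_inner continuous_intros open_Collect_const)
    fix u assume u: "u \<in> sphere (0::'a) 1"
    show "(x0, u) \<notin> ?C j"
    proof
      assume "(x0, u) \<in> ?C j"
      then have a: "0 \<le> u \<bullet> w" "u \<bullet> r j x0 \<le> 0"
        "\<And>i k. i \<in> I \<Longrightarrow> k \<in> I \<Longrightarrow> u \<bullet> r i x0 = u \<bullet> r k x0"
        unfolding mem_Collect_eq fst_conv snd_conv by blast+
      obtain k where k: "k \<in> I" using facet_at_originD(2)[OF facet] by blast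
      have "sum l I * (u \<bullet> r k x0) = (\<Sum>i\<in>I. l i * (u \<bullet> r i x0))"
        unfolding sum_distrib_right by (intro sum.cong refl arg_cong2[where f=times] a(3)[OF k])
      also have "\<dots> = u \<bullet> (\<Sum>i\<in>I. l i *\<^sub>R r i x0)"
        by (simp add: inner_sum_right)
      also have "\<dots> = 0" by (simp add: facet_at_originD(7)[OF facet])
      finally have "sum l I * (u \<bullet> r k x0) = 0" .
      moreover have "0 < sum l I" using k facet_at_originD(6)[OF facet] by (intro sum_pos) auto
      ultimately have "u \<bullet> r k x0 = 0" by simp
      then have "0 \<le> u \<bullet> r i x0" if "i \<in> I" for i using a(3)[OF that k] by simp
      then obtain c where c: "u = c *\<^sub>R w" using facet_orthogonal by blast
      have "w \<bullet> w = 1" by (simp add: dot_square_norm facet_at_originD(1)[OF facet])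
      then have "0 \<le> c" using a(1) c by simp
      moreover have "0 < w \<bullet> r j x0" using j by (rule facet_at_originD(5)[OF facet])
      then have "c \<le> 0" using a(2) c by (simp add: mult_le_0_iff)
      ultimately show False using u c by auto
    qed
  qed simp_all
  then have "\<forall>\<^sub>F x in nhds x0. \<forall>j\<in>- I. \<forall>u\<in>sphere 0 1. (x, u) \<notin> ?C j"
    by (simp add: eventually_ball_finite)
  then show ?thesis
  proof eventually_elim
    case (elim x)
    show ?case
    proof (intro ballI impI allI, rule ccontr)
      fix u j assume u: "u \<in> sphere 0 1" "0 \<le> u \<bullet> w \<and> (\<forall>i\<in>I. \<forall>k\<in>I. u \<bullet> r i x = u \<bullet> r k x)"
        and j: "j \<notin> I" "\<not> 0 < u \<bullet> r j x"
      have "(x, u) \<in> ?C j"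
        using u(2) j(2) unfolding mem_Collect_eq fst_conv snd_conv not_less by blast
      then show False using elim u(1) j(1) by blast
    qed
  qed
qed

end

end

text \<open>Near \<open>x0\<close> the facet lies in a hyperplane at a height \<open>c \<noteq> 0\<close> in the direction \<open>u\<close>; the origin
  is cut off from the first hull if \<open>c > 0\<close> and from the second, whose facet is the negative of the
  first, if \<open>c < 0\<close>. If \<open>v\<close> and \<open>v'\<close> cut off the origin from both hulls, then a combination of them
  orthogonal to \<open>w\<close> is negative on the whole facet, which is impossible because the origin lies in
  its relative interior.\<close>

lemma eventually_exactly_one_avoids:
  fixes r r' :: "'n::finite \<Rightarrow> 'x::topological_space \<Rightarrow> 'a::euclidean_space"
  assumes cont: "\<And>j. continuous_on UNIV (r j)" "\<And>j. continuous_on UNIV (r' j)"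
    and facet: "facet_at_origin I w l (\<lambda>j. r j x0)" "facet_at_origin I w l (\<lambda>j. r' j x0)"
    and opp: "\<And>i x. i \<in> I \<Longrightarrow> r' i x = - r i x"
  shows "\<forall>\<^sub>F x in nhds x0. \<not> dependent_family I (\<lambda>j. r j x) \<longrightarrow>
    (0 \<notin> convex hull (range (\<lambda>j. r j x)) \<longleftrightarrow> 0 \<in> convex hull (range (\<lambda>j. r' j x)))"
  using eventually_separator_near_normal[OF cont(1) facet(1)]
    eventually_separator_near_normal[OF cont(2) facet(2)]
    eventually_no_tangent_separator[OF cont(1) facet(1)]
    eventually_equal_heights_imp_pos[OF cont(1) facet(1)]
    eventually_equal_heights_imp_pos[OF cont(2) facet(2)]
proof eventually_elim
  case (elim x)
  obtain k where k: "k \<in> I" using facet_at_originD(2)[OF facet(1)] by blast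
  show ?case
  proof (intro impI iffI)
    assume "0 \<notin> convex hull (range (\<lambda>j. r j x))"
    then obtain v where v: "norm v = 1" "\<And>j. 0 < v \<bullet> r j x" by (auto simp: not_in_hull_iff)
    show "0 \<in> convex hull (range (\<lambda>j. r' j x))"
    proof (rule ccontr)
      assume "0 \<notin> convex hull (range (\<lambda>j. r' j x))"
      then obtain v' where v': "norm v' = 1" "\<And>j. 0 < v' \<bullet> r' j x" by (auto simp: not_in_hull_iff)
      have vw: "0 < v \<bullet> w" using elim(1) v by (auto simp: less_imp_le)
      have v'w: "0 < v' \<bullet> w" using elim(2) v' by (auto simp: less_imp_le)
      \<comment> \<open>The coefficients cancel the component along \<open>w\<close>. Both are
        positive, and \<open>r'\<close> is the negative of \<open>r\<close> on the facet, so both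
        terms are negative there.\<close>
      define f where "f = (v \<bullet> w) *\<^sub>R v' - (v' \<bullet> w) *\<^sub>R v"
      have "f \<bullet> w = 0" by (simp add: f_def inner_diff_left)
      then obtain i where i: "i \<in> I" "0 \<le> f \<bullet> r i x" using elim(3) by blast
      have "v' \<bullet> r i x < 0" using v'(2)[of i] opp[OF i(1)] by simp
      then have "(v \<bullet> w) * (v' \<bullet> r i x) < 0" using vw by (simp add: mult_pos_neg)
      moreover have "0 < (v' \<bullet> w) * (v \<bullet> r i x)" using v'w v(2) by simp
      ultimately have "f \<bullet> r i x < 0" by (simp add: f_def inner_diff_left)
      then show False using i(2) by simp
    qed
  next
    assume nd: "\<not> dependent_family I (\<lambda>j. r j x)" and h': "0 \<in> convex hull (range (\<lambda>j. r' j x))"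
    obtain u0 where u0: "\<And>i. i \<in> I \<Longrightarrow> u0 \<bullet> r i x = 1"
      using exists_functional_one[OF nd] by auto
    \<comment> \<open>Scaling \<open>u0\<close> to length 1 and turning it to the side of
      \<open>w\<close> makes \<open>c\<close> the signed height of the facet.\<close>
    define c where "c = (if 0 \<le> u0 \<bullet> w then 1 else - 1) / norm u0"
    define u where "u = c *\<^sub>R u0"
    have "u0 \<noteq> 0" using u0[OF k] by auto
    then have c0: "c \<noteq> 0" and u: "u \<in> sphere 0 1" "0 \<le> u \<bullet> w"
      by (auto simp: u_def c_def divide_simps)
    have uI: "u \<bullet> r i x = c" "u \<bullet> r' i x = - c" if "i \<in> I" for i
      using u0[OF that] opp[OF that] by (auto simp: u_def)
    have pos: "0 < u \<bullet> r j x" if "j \<notin> I" for j using elim(4) u uI that by auto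
    have pos': "0 < u \<bullet> r' j x" if "j \<notin> I" for j using elim(5) u uI that by auto
    have "\<not> c < 0"
    proof
      assume "c < 0"
      then have "0 < u \<bullet> r' j x" for j using uI pos' by (cases "j \<in> I") auto
      then show False using h' u not_in_hull_iff[of "\<lambda>j. r' j x"] by auto
    qed
    then have "0 < c" using c0 by simp
    then have "0 < u \<bullet> r j x" for j using uI pos by (cases "j \<in> I") auto
    then show "0 \<notin> convex hull (range (\<lambda>j. r j x))"
      using u not_in_hull_iff[of "\<lambda>j. r j x"] by auto
  qed
qed

section \<open>Counting\<close>

text \<open>All conditions on the facet vectors are linear equations, so negating them preserves
  these with the same \<open>w\<close> and \<open>l\<close>.\<close>

lemma facet_at_origin_opposite:
  assumes "facet_at_origin I w l q" "\<And>i. i \<in> I \<Longrightarrow> q' i = - q i" "\<And>j. j \<notin> I \<Longrightarrow> 0 < w \<bullet> q' j"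
  shows "facet_at_origin I w l q'"
proof -
  have "(\<Sum>i\<in>I. l i *\<^sub>R q' i) = - (\<Sum>i\<in>I. l i *\<^sub>R q i)"
    using assms(2) by (simp add: sum_negf[symmetric])
  then show ?thesis using assms unfolding facet_at_origin_def by simp
qed

text \<open>The values of \<open>v\<close> on the facet have weighted sum 0 with positive weights,
  so they cannot all be positive.\<close>

lemma facet_at_origin_not_separated:
  fixes q :: "'n::finite \<Rightarrow> 'a::real_inner"
  assumes "facet_at_origin I w l q"
  obtains i where "i \<in> I" "v \<bullet> q i \<le> 0"
proof (rule ccontr)
  assume "\<not> thesis"
  then have "0 < v \<bullet> q i" if "i \<in> I" for i using that \<open>\<And>i. i \<in> I \<Longrightarrow> v \<bullet> q i \<le> 0 \<Longrightarrow> thesis\<close> by force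
  then have "0 < (\<Sum>i\<in>I. l i * (v \<bullet> q i))"
    using facet_at_originD(2,6)[OF assms] by (intro sum_pos) auto
  also have "\<dots> = v \<bullet> (\<Sum>i\<in>I. l i *\<^sub>R q i)" by (simp add: inner_sum_right)
  also have "\<dots> = 0" by (simp add: facet_at_originD(7)[OF assms])
  finally show False by simp
qed

lemma continuous_on_psum_act: "continuous_on UNIV (\<lambda>X. psum k (act g X))"
  unfolding psum_def column_act unfolding column_def
  by (intro continuous_intros)

lemma finite_signed_perms: "finite (signed_perms :: 'n::finite signed_perm set)"
proof -
  have "finite (UNIV \<rightarrow>\<^sub>E {-1, 1} :: ('n \<Rightarrow> real) set)" by (rule finite_PiE) auto
  then have "finite ((UNIV :: ('n \<Rightarrow> 'n) set) \<times> (UNIV \<rightarrow>\<^sub>E {-1, 1} :: ('n \<Rightarrow> real) set))"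
    by (rule finite_cartesian_product[OF finite])
  moreover have "(signed_perms :: 'n signed_perm set) \<subseteq> UNIV \<times> (UNIV \<rightarrow>\<^sub>E {-1, 1})"
    by (auto simp: signed_perms_def)
  ultimately show ?thesis by (rule finite_subset[rotated])
qed

text \<open>The involution exchanges \<open>G \<inter> A\<close> and \<open>G - A\<close>.\<close>

lemma card_exactly_one_of_involution:
  assumes "finite G" "\<And>g. g \<in> G \<Longrightarrow> \<phi> g \<in> G" "\<And>g. g \<in> G \<Longrightarrow> \<phi> (\<phi> g) = g"
    and "\<And>g. g \<in> G \<Longrightarrow> g \<in> A \<longleftrightarrow> \<phi> g \<notin> A"
  shows "card (G \<inter> A) = card G div 2"
proof -
  have "bij_betw \<phi> (G \<inter> A) (G - A)"
    by (rule bij_betwI[where g=\<phi>]) (use assms(2-4) in auto)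
  then have "card (G \<inter> A) = card (G - A)" by (rule bij_betw_same_card)
  moreover have "card G = card (G \<inter> A) + card (G - A)"
    using assms(1) card_Int_Diff by blast
  ultimately show ?thesis by simp
qed

text \<open>At \<open>X0\<close> the origin is outside the hull for \<open>g\<close> in
  \<open>A\<close>, on its boundary for \<open>g\<close> in \<open>G\<close>, and interior
  otherwise. These classes contribute fully, by half and not at all, so \<open>N\<close> is
  \<open>card A + card G div 2\<close>, which depends on \<open>X0\<close> alone.\<close>

lemma eventually_card_avoiders:
  fixes X0 :: "real^'n::{finite,linorder}^'d"
  assumes n: "CARD('d) < CARD('n)"
    and uniq: "\<forall>g\<in>signed_perms. \<exists>\<^sub>\<le>\<^sub>1 I. card I = CARD('d) \<and> X0 \<in> degenerate_at g I"
  obtains N where "\<forall>\<^sub>F X in nhds X0. regular X \<longrightarrow> card (avoiders X) = N"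
proof -
  define q where "q g j = psum j (act g X0)" for g j
  define S where "S g \<longleftrightarrow> (\<exists>v. norm v = 1 \<and> (\<forall>j. 0 < v \<bullet> q g j))" for g
  define W where "W g \<longleftrightarrow> (\<exists>v. norm v = 1 \<and> (\<forall>j. 0 \<le> v \<bullet> q g j))" for g
  define A where "A = {g \<in> signed_perms. S g}"
  define G where "G = {g \<in> signed_perms. W g \<and> \<not> S g}"
  have fin: "finite A" "finite G" by (auto simp: A_def G_def finite_signed_perms)
  have uq: "\<exists>\<^sub>\<le>\<^sub>1 I. card I = CARD('d) \<and> dependent_family I (q g)" if "g \<in> signed_perms" for g
    using uniq that by (simp add: degenerate_at_def q_def[abs_def])
  have "\<exists>I. card I = CARD('d) \<and> dependent_family I (q g) \<and> (\<exists>w l. facet_at_origin I w l (q g))"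
    if g: "g \<in> G" for g
  proof -
    have gs: "g \<in> signed_perms" and "\<not> S g" and "W g" using g by (auto simp: G_def)
    then obtain w where w: "norm w = 1" "\<And>j. 0 \<le> w \<bullet> q g j" by (auto simp: W_def)
    have hull: "0 \<in> convex hull (range (q g))"
      using \<open>\<not> S g\<close> not_in_hull_iff[of "q g"] unfolding S_def by blast
    from facet_at_origin_exists[OF _ _ w hull] uq[OF gs] n show ?thesis by auto metis
  qed
  then obtain J where J: "\<And>g. g \<in> G \<Longrightarrow> card (J g) = CARD('d)"
      "\<And>g. g \<in> G \<Longrightarrow> dependent_family (J g) (q g)"
      "\<And>g. g \<in> G \<Longrightarrow> \<exists>w l. facet_at_origin (J g) w l (q g)"
    by metis
  define \<phi> where "\<phi> g = reverse_blocks (J g) g" for g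
  have facet': "facet_at_origin (J g) w l (q (\<phi> g))"
    if "g \<in> G" "facet_at_origin (J g) w l (q g)" for g w l
    using that(2)
  proof (rule facet_at_origin_opposite)
    show "q (\<phi> g) i = - q g i" if "i \<in> J g" for i
      unfolding q_def \<phi>_def by (rule psum_reverse_blocks_boundary[OF that])
    show "0 < w \<bullet> q (\<phi> g) j" if "j \<notin> J g" for j
      unfolding q_def \<phi>_def
      using psum_reverse_blocks_inner_pos facet_at_originD(4,5)[OF \<open>facet_at_origin (J g) w l (q g)\<close>] that
      unfolding q_def by blast
  qed
  have \<phi>G: "\<phi> g \<in> G" if g: "g \<in> G" for g
  proof -
    obtain w l where "facet_at_origin (J g) w l (q g)" using J(3)[OF g] by blast
    note f = facet'[OF g this]
    have "0 \<le> w \<bullet> q (\<phi> g) j" for j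
      using facet_at_originD(4,5)[OF f, of j] by (cases "j \<in> J g") auto
    then have "W (\<phi> g)" unfolding W_def using facet_at_originD(1)[OF f] by blast
    moreover have "\<not> S (\<phi> g)" unfolding S_def
      using facet_at_origin_not_separated[OF f] by (metis not_less)
    moreover have "\<phi> g \<in> signed_perms"
      unfolding \<phi>_def using g by (intro reverse_blocks_signed_perms) (simp add: G_def)
    ultimately show ?thesis by (simp add: G_def)
  qed
  have \<phi>\<phi>: "\<phi> (\<phi> g) = g" if g: "g \<in> G" for g
  proof -
    \<comment> \<open>The second reversal uses the blocks of \<open>J (\<phi> g)\<close>. Dependence
      survives the sign change, so uniqueness for \<open>\<phi> g\<close> identifies this set with
      \<open>J g\<close>.\<close>
    have "dependent_family (J g) (q (\<phi> g)) \<longleftrightarrow> dependent_family (J g) (q g)"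
      unfolding q_def \<phi>_def by (rule dependent_family_uminus) (rule psum_reverse_blocks_boundary)
    then have "J (\<phi> g) = J g"
      using uq[of "\<phi> g"] J(1,2)[OF g] J(1,2)[OF \<phi>G[OF g]] \<phi>G[OF g]
      unfolding Uniq_def G_def by blast
    then show ?thesis unfolding \<phi>_def[of "\<phi> g"] by (simp add: \<phi>_def reverse_blocks_reverse_blocks)
  qed
  have one: "\<forall>\<^sub>F X in nhds X0. regular X \<longrightarrow> (g \<in> avoiders X \<longleftrightarrow> \<phi> g \<notin> avoiders X)"
    if g: "g \<in> G" for g
  proof -
    obtain w l where f: "facet_at_origin (J g) w l (q g)" using J(3)[OF g] by blast
    have "\<forall>\<^sub>F X in nhds X0. \<not> dependent_family (J g) (\<lambda>j. psum j (act g X)) \<longrightarrow>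
      (0 \<notin> walk_hull (act g X) \<longleftrightarrow> 0 \<in> walk_hull (act (\<phi> g) X))"
      unfolding walk_hull_def
      using f facet'[OF g f] unfolding q_def
    proof (rule eventually_exactly_one_avoids[OF continuous_on_psum_act continuous_on_psum_act])
      show "psum i (act (\<phi> g) X) = - psum i (act g X)" if "i \<in> J g" for i X
        unfolding \<phi>_def by (rule psum_reverse_blocks_boundary[OF that])
    qed
    then show ?thesis
    proof eventually_elim
      case (elim X)
      show ?case
      proof
        assume "regular X"
        then have "\<not> dependent_family (J g) (\<lambda>j. psum j (act g X))"
          using g J(1)[OF g] by (auto simp: regular_def degenerate_def degenerate_at_def G_def)
        then show "g \<in> avoiders X \<longleftrightarrow> \<phi> g \<notin> avoiders X"
          using elim g \<phi>G[OF g] by (simp add: avoiders_def G_def)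
      qed
    qed
  qed
  have "\<forall>\<^sub>F X in nhds X0. \<forall>g\<in>G. regular X \<longrightarrow> (g \<in> avoiders X \<longleftrightarrow> \<phi> g \<notin> avoiders X)"
    by (rule eventually_ball_finite[OF fin(2)], rule ballI, rule one)
  moreover have "\<forall>\<^sub>F X in nhds X0. \<forall>g\<in>A. g \<in> avoiders X"
  proof (rule eventually_ball_finite[OF fin(1)], rule ballI)
    fix g assume g: "g \<in> A"
    then obtain v where v: "norm v = 1" "\<And>j. 0 < v \<bullet> psum j (act g X0)"
      unfolding A_def S_def q_def by blast
    from eventually_origin_avoided[of "\<lambda>j X. psum j (act g X)", OF continuous_on_psum_act v]
    show "\<forall>\<^sub>F X in nhds X0. g \<in> avoiders X"
      using g by (simp add: avoiders_def walk_hull_def A_def)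
  qed
  moreover have "\<forall>\<^sub>F X in nhds X0. \<forall>g\<in>signed_perms - A - G. g \<notin> avoiders X"
  proof (rule eventually_ball_finite, use finite_signed_perms in blast, rule ballI)
    fix g assume "g \<in> signed_perms - A - G"
    then have "\<not> W g" by (auto simp: A_def G_def)
    then have v: "\<exists>j. v \<bullet> psum j (act g X0) < 0" if "norm v = 1" for v
      using that unfolding W_def q_def by (metis not_le)
    from eventually_origin_in_hull[of "\<lambda>j X. psum j (act g X)", OF continuous_on_psum_act v]
    show "\<forall>\<^sub>F X in nhds X0. g \<notin> avoiders X"
      by (simp add: avoiders_def walk_hull_def)
  qed
  ultimately have "\<forall>\<^sub>F X in nhds X0. regular X \<longrightarrow> card (avoiders X) = card A + card G div 2"
  proof eventually_elim
    case (elim X)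
    show ?case
    proof
      assume "regular X"
      then have "card (G \<inter> avoiders X) = card G div 2"
        using elim(1) by (intro card_exactly_one_of_involution[OF fin(2) \<phi>G \<phi>\<phi>]) blast+
      moreover have "avoiders X = A \<union> (G \<inter> avoiders X)"
        using elim(2,3) by (auto simp: avoiders_def)
      moreover have "card (A \<union> (G \<inter> avoiders X)) = card A + card (G \<inter> avoiders X)"
        using fin by (intro card_Un_disjoint) (auto simp: A_def G_def)
      ultimately show "card (avoiders X) = card A + card G div 2" by simp
    qed
  qed
  then show thesis by (rule that)
qed

theorem proposition10:
  fixes \<gamma> :: "real \<Rightarrow> real^'n::{finite,linorder}^'d"
  assumes "CARD('n) \<ge> CARD('d) + 1"
    and "piecewise_linear_on (-1) 1 \<gamma>"
    and "\<gamma> 0 \<in> degenerate"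
    and "\<forall>t\<in>{-1..1}. t \<noteq> 0 \<longrightarrow> regular (\<gamma> t)"
    and "\<forall>g\<in>signed_perms. \<exists>\<^sub>\<le>\<^sub>1 I. card I = CARD('d) \<and> \<gamma> 0 \<in> degenerate_at g I"
  shows "\<exists>\<delta>>0. \<exists>N. \<forall>t\<in>{-1..1}. 0 < \<bar>t\<bar> \<and> \<bar>t\<bar> < \<delta> \<longrightarrow> card (avoiders (\<gamma> t)) = N"
proof -
  have "CARD('d) < CARD('n)" using assms(1) by simp
  from eventually_card_avoiders[OF this assms(5)] obtain N
    where N: "\<forall>\<^sub>F X in nhds (\<gamma> 0). regular X \<longrightarrow> card (avoiders X) = N" .
  \<comment> \<open>Continuity at 0 pulls the neighbourhood of \<open>\<gamma> 0\<close> back to a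
    punctured interval of times, where the path is regular.\<close>
  have "(\<gamma> \<longlongrightarrow> \<gamma> 0) (at 0 within {-1..1})"
    using assms(2) by (simp add: piecewise_linear_on_def continuous_on_def)
  from eventually_compose_filterlim[OF N this] obtain \<delta> where \<delta>: "\<delta> > 0"
    "\<And>t. t \<in> {-1..1} \<Longrightarrow> t \<noteq> 0 \<Longrightarrow> dist t 0 < \<delta> \<Longrightarrow> regular (\<gamma> t) \<longrightarrow> card (avoiders (\<gamma> t)) = N"
    unfolding eventually_at by blast
  have "card (avoiders (\<gamma> t)) = N" if "t \<in> {-1..1}" "0 < \<bar>t\<bar> \<and> \<bar>t\<bar> < \<delta>" for t
    using \<delta>(2)[of t] assms(4) that by (simp add: dist_real_def)
  then show ?thesis using \<delta>(1) by blast
qed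

end
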